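(* Let $\mathcal A$ be a $C^*$-algebra, let $\mathcal X$ and $\mathcal Y$ be Hilbert $\mathcal A$-modules, let $\varphi:\mathcal X\times\mathcal Y\to[0,\infty)$ be a function, and let $f:\mathcal X\to\mathcal Y$ and $g:\mathcal Y\to\mathcal X$ be everywhere defined (not necessarily linear) mappings such that $$\|\langle f(x),y\rangle-\langle x,g(y)\rangle\|\le\varphi(x,y)\qquad(x\in\mathcal X,\ y\in\mathcal Y),$$ i.e. $f$ is a $\varphi$-perturbation of an adjointable mapping with corresponding mapping $g$. Suppose that for some sequence $\{c_n\}$ of non-zero complex numbers either both of the conditions $$\lim_{n\to\infty}|c_n|^{-1}\varphi(c_nx,y)=0\quad\text{and}\quad \lim_{n\to\infty}|c_n|^{-1}\varphi(x,c_ny)=0\qquad(x\in\mathcal X,\ y\in\mathcal Y)$$ hold, or both of the conditions $$\lim_{n\to\infty}|c_n|\,\varphi(c_n^{-1}x,y)=0\quad\text{and}\quad \lim_{n\to\infty}|c_n|\,\varphi(x,c_n^{-1}y)=0\qquad(x\in\mathcal X,\ y\in\mathcal Y)$$ hold. Then $f$ is adjointable. In particular, $f$ is bounded, continuous and $\mathcal A$-linear, and its adjoint is $g$, i.e. $\langle f(x),y\rangle=\langle x,g(y)\rangle$ for all $x\in\mathcal X$, $y\in\mathcal Y$.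
   Context: A (right) Hilbert $\mathcal A$-module is a complex linear space $\mathcal X$ that is a right $\mathcal A$-module with $\lambda(xa)=x(\lambda a)=(\lambda x)a$ for $x\in\mathcal X$, $a\in\mathcal A$, $\lambda\in\mathbb C$, equipped with an $\mathcal A$-valued inner product $\langle\cdot,\cdot\rangle:\mathcal X\times\mathcal X\to\mathcal A$ satisfying: (i) $\langle x,x\rangle\ge0$, with $\langle x,x\rangle=0$ iff $x=0$; (ii) $\langle x,y+\lambda z\rangle=\langle x,y\rangle+\lambda\langle x,z\rangle$; (iii) $\langle x,ya\rangle=\langle x,y\rangle a$; (iv) $\langle x,y\rangle^*=\langle y,x\rangle$; and complete for the norm $\|x\|=\|\langle x,x\rangle\|^{1/2}$. An everywhere defined mapping $f:\mathcal X\to\mathcal Y$ (no linearity assumed) is called adjointable if there is a mapping $g:\mathcal Y\to\mathcal X$ with $\langle f(x),y\rangle=\langle x,g(y)\rangle$ for all $x\in\mathcal X$, $y\in\mathcal Y$; this (unique) $g$ is called the adjoint of $f$ and denoted $f^*$. $\mathcal A$-linear means $\mathbb C$-linear and commuting with the right $\mathcal A$-action. *)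

theory Defs
  imports "HOL-Analysis.Analysis"
begin

text \<open>Complex vector spaces; the real vector space structure of the library classes is the
  restriction of the complex one.\<close>

class complex_vector = real_vector +
  fixes scaleC :: "complex \<Rightarrow> 'a \<Rightarrow> 'a" (infixr "*\<^sub>C" 75)
  assumes scaleC_add_right: "c *\<^sub>C (x + y) = c *\<^sub>C x + c *\<^sub>C y"
    and scaleC_add_left: "(c + d) *\<^sub>C x = c *\<^sub>C x + d *\<^sub>C x"
    and scaleC_scaleC: "c *\<^sub>C d *\<^sub>C x = (c * d) *\<^sub>C x"
    and scaleC_one: "1 *\<^sub>C x = x"
    and scaleR_scaleC: "r *\<^sub>R x = complex_of_real r *\<^sub>C x"

text \<open>C*-algebras, not assumed to be unital.\<close>

class cstar_algebra = complex_vector + real_normed_algebra + banach +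
  fixes star :: "'a \<Rightarrow> 'a"
  assumes scaleC_mult_left: "(c *\<^sub>C x) * y = c *\<^sub>C (x * y)"
    and scaleC_mult_right: "x * (c *\<^sub>C y) = c *\<^sub>C (x * y)"
    and norm_scaleC: "norm (c *\<^sub>C x) = cmod c * norm x"
    and star_add: "star (x + y) = star x + star y"
    and star_scaleC: "star (c *\<^sub>C x) = cnj c *\<^sub>C star x"
    and star_mult: "star (x * y) = star y * star x"
    and star_star: "star (star x) = x"
    and cstar_identity: "norm (star x * x) = (norm x)\<^sup>2"

definition cstar_positive :: "'a::cstar_algebra \<Rightarrow> bool"
  where "cstar_positive a \<longleftrightarrow> (\<exists>b. a = star b * b)"

text \<open>A right Hilbert module over \<open>'a\<close>. Its norm is the norm of the type \<open>'x\<close>, tied to the inner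
  product by \<open>norm_ip\<close>; completeness with respect to it is the class \<open>banach\<close>.
  The module action is not required to be unital, since \<open>'a\<close> need not have a unit.\<close>

locale hilbert_module =
  fixes act :: "'x::{complex_vector,banach} \<Rightarrow> 'a::cstar_algebra \<Rightarrow> 'x"
    and ip :: "'x \<Rightarrow> 'x \<Rightarrow> 'a"
  assumes act_add_left: "act (x + y) a = act x a + act y a"
    and act_add_right: "act x (a + b) = act x a + act x b"
    and act_mult: "act x (a * b) = act (act x a) b"
    and act_scaleC_right: "act x (c *\<^sub>C a) = c *\<^sub>C act x a"
    and act_scaleC_left: "act (c *\<^sub>C x) a = c *\<^sub>C act x a"
    and ip_positive: "cstar_positive (ip x x)"
    and ip_eq_zero_iff: "ip x x = 0 \<longleftrightarrow> x = 0"
    and ip_linear_right: "ip x (y + c *\<^sub>C z) = ip x y + c *\<^sub>C ip x z"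
    and ip_act_right: "ip x (act y a) = ip x y * a"
    and star_ip: "star (ip x y) = ip y x"
    and norm_ip: "norm x = sqrt (norm (ip x x))"

definition is_adjoint ::
    "('x \<Rightarrow> 'x \<Rightarrow> 'a) \<Rightarrow> ('y \<Rightarrow> 'y \<Rightarrow> 'a) \<Rightarrow> ('x \<Rightarrow> 'y) \<Rightarrow> ('y \<Rightarrow> 'x) \<Rightarrow> bool"
  where "is_adjoint ipX ipY f g \<longleftrightarrow> (\<forall>x y. ipY (f x) y = ipX x (g y))"

definition adjointable ::
    "('x \<Rightarrow> 'x \<Rightarrow> 'a) \<Rightarrow> ('y \<Rightarrow> 'y \<Rightarrow> 'a) \<Rightarrow> ('x \<Rightarrow> 'y) \<Rightarrow> bool"
  where "adjointable ipX ipY f \<longleftrightarrow> (\<exists>g. is_adjoint ipX ipY f g)"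

definition module_adjoint ::
    "('x \<Rightarrow> 'x \<Rightarrow> 'a) \<Rightarrow> ('y \<Rightarrow> 'y \<Rightarrow> 'a) \<Rightarrow> ('x \<Rightarrow> 'y) \<Rightarrow> 'y \<Rightarrow> 'x"
  where "module_adjoint ipX ipY f = (THE g. is_adjoint ipX ipY f g)"

definition module_linear ::
    "('x::complex_vector \<Rightarrow> 'a \<Rightarrow> 'x) \<Rightarrow> ('y::complex_vector \<Rightarrow> 'a \<Rightarrow> 'y) \<Rightarrow> ('x \<Rightarrow> 'y) \<Rightarrow> bool"
  where "module_linear actX actY f \<longleftrightarrow>
    (\<forall>x x'. f (x + x') = f x + f x') \<and>
    (\<forall>c x. f (c *\<^sub>C x) = c *\<^sub>C f x) \<and>
    (\<forall>x a. f (actX x a) = actY (f x) a)"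

end

theory Submission
  imports Defs
begin

text \<open>
  Assume the first pair of limit conditions and put \<open>h n y = (c n)\<inverse> g (c n y)\<close>. Dividing the perturbation inequality at \<open>(x, c n y)\<close> by \<open>c n\<close>
  shows that \<open>\<langle>x, h n y\<rangle>\<close> tends to \<open>\<langle>f x, y\<rangle>\<close>. For fixed \<open>y\<close> each of these approximants is conjugate
  linear in \<open>x\<close> and turns the action of \<open>a\<close> into left multiplication by \<open>star a\<close>. The limit
  inherits these laws, and since the inner product is nondegenerate, \<open>f\<close> itself is
  \<open>\<A>\<close>-linear (\<open>module_linear_if_limit\<close>), although nothing is known yet about \<open>g\<close>. Once \<open>f\<close> is
  homogeneous, the defect \<open>\<langle>f x, y\<rangle> - \<langle>x, g y\<rangle>\<close> gets multiplied by a number of modulus \<open>\<bar>c n\<bar>\<close> when \<open>x\<close>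
  is replaced by \<open>c n x\<close>; the hypothesis on \<open>\<phi> (c n x) y\<close> then forces it to vanish
  (\<open>perturbed_adjoint_exact\<close>). The second pair of limit conditions is the first pair for the
  sequence of inverses.

  Boundedness is a Hellinger--Toeplitz argument: for \<open>y\<close> in the unit ball the maps
  \<open>x \<mapsto> \<langle>x, g y\<rangle> = \<langle>f x, y\<rangle>\<close> are bounded and real linear, and they are pointwise bounded in \<open>y\<close>, so the
  principle of uniform boundedness applies. The inner product has to be bounded for this, but
  only up to a constant, and polarization together with the triangle inequality of the
  given norm yields \<open>\<parallel>\<langle>x, y\<rangle>\<parallel> \<le> 4 \<parallel>x\<parallel> \<parallel>y\<parallel>\<close> (\<open>norm_ip_le\<close>).
\<close>

section \<open>The principle of uniform boundedness\<close>

text \<open>By Baire's theorem one of the closed sets on which the family is bounded by \<open>n\<close> contains a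
  ball; differences of points of that ball reach every direction.\<close>

lemma uniform_boundedness:
  fixes T :: "'i \<Rightarrow> 'b::banach \<Rightarrow> 'c::real_normed_vector"
  assumes lin: "\<And>i. i \<in> I \<Longrightarrow> bounded_linear (T i)"
    and ptw: "\<And>x. \<exists>M. \<forall>i\<in>I. norm (T i x) \<le> M"
  shows "\<exists>K. \<forall>i\<in>I. \<forall>x. norm (T i x) \<le> K * norm x"
proof -
  define E where "E n = {x. \<forall>i\<in>I. norm (T i x) \<le> real n}" for n
  have "closed (E n)" for n
  proof -
    have "E n = (\<Inter>i\<in>I. {x. norm (T i x) \<le> real n})"
      by (auto simp: E_def)
    moreover have "closed {x. norm (T i x) \<le> real n}" if "i \<in> I" for i
      by (intro closed_Collect_le continuous_intros linear_continuous_on lin that)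
    ultimately show ?thesis by auto
  qed
  have "\<Union>(range E) = UNIV"
  proof -
    have "\<exists>n. x \<in> E n" for x
    proof -
      obtain M where "\<forall>i\<in>I. norm (T i x) \<le> M"
        using ptw by blast
      moreover obtain n where "M \<le> real n"
        using real_arch_simple by blast
      ultimately show ?thesis
        unfolding E_def by (auto intro: order_trans)
    qed
    then show ?thesis by auto
  qed
  have "\<exists>n. interior (E n) \<noteq> {}"
  proof (rule ccontr)
    assume "\<nexists>n. interior (E n) \<noteq> {}"
    then have "euclidean interior_of \<Union>(range E) = {}"
      using \<open>\<And>n. closed (E n)\<close>
      by (intro Baire_category_alt disjI1 completely_metrizable_space_euclidean) auto
    with \<open>\<Union>(range E) = UNIV\<close> show False by simp
  qed
  then obtain n a e where "e > 0" and ball: "ball a e \<subseteq> E n"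
    by (metis ex_in_conv mem_interior)
  have "norm (T i x) \<le> 4 * real n / e * norm x" if "i \<in> I" for i x
  proof (cases "x = 0")
    case True
    then show ?thesis
      using lin[OF that] by (simp add: linear_simps)
  next
    case False
    interpret T: bounded_linear "T i"
      using lin[OF that] .
    define r where "r = e / (2 * norm x)"
    have "r > 0"
      using False \<open>e > 0\<close> by (simp add: r_def)
    have "norm (r *\<^sub>R x) < e"
      using False \<open>e > 0\<close> by (simp add: r_def)
    then have "a + r *\<^sub>R x \<in> E n" "a \<in> E n"
      using ball \<open>e > 0\<close> by (auto simp: dist_norm subset_iff)
    then have le: "norm (T i (a + r *\<^sub>R x)) \<le> real n" "norm (T i a) \<le> real n"
      using that by (auto simp: E_def)
    have "r * norm (T i x) = norm (T i (a + r *\<^sub>R x) - T i a)"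
      using \<open>r > 0\<close> by (simp add: T.add T.scaleR)
    also have "\<dots> \<le> 2 * real n"
      using le norm_triangle_ineq4[of "T i (a + r *\<^sub>R x)" "T i a"] by linarith
    finally show ?thesis
      using False \<open>e > 0\<close> by (simp add: r_def field_simps)
  qed
  then show ?thesis by blast
qed

section \<open>Inner products of Hilbert modules\<close>

lemma bounded_linear_scaleC: "bounded_linear (\<lambda>x::'a::cstar_algebra. c *\<^sub>C x)"
proof (rule bounded_linear_intro)
  show "c *\<^sub>C (x + y) = c *\<^sub>C x + c *\<^sub>C y" for x y :: 'a
    by (rule scaleC_add_right)
  show "c *\<^sub>C r *\<^sub>R x = r *\<^sub>R c *\<^sub>C x" for r and x :: 'a
    by (simp add: scaleR_scaleC scaleC_scaleC mult.commute)
  show "norm (c *\<^sub>C x) \<le> norm x * cmod c" for x :: 'a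
    by (simp add: norm_scaleC mult.commute)
qed

lemmas tendsto_scaleC = bounded_linear.tendsto[OF bounded_linear_scaleC]

lemma scaleC_diff_right: "c *\<^sub>C (x - y) = c *\<^sub>C x - c *\<^sub>C (y::'v::complex_vector)"
  using scaleC_add_right[of c "x - y" y] by (simp add: algebra_simps)

lemma scaleC_minus_left: "(- c) *\<^sub>C x = - (c *\<^sub>C (x::'v::complex_vector))"
  using scaleR_scaleC[of "-1" "c *\<^sub>C x"] by (simp add: scaleC_scaleC)

context hilbert_module
begin

lemma ip_add_right: "ip x (y + z) = ip x y + ip x z"
  using ip_linear_right[of x y 1 z] by (simp add: scaleC_one)

lemma ip_zero_right: "ip x 0 = 0"
  using ip_add_right[of x 0 0] by simp

lemma ip_scaleC_right: "ip x (c *\<^sub>C y) = c *\<^sub>C ip x y"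
  using ip_linear_right[of x 0 c y] by (simp add: ip_zero_right)

lemma ip_diff_right: "ip x (y - z) = ip x y - ip x z"
  using ip_add_right[of x "y - z" z] by (simp add: algebra_simps)

lemma ip_add_left: "ip (x + y) z = ip x z + ip y z"
  by (metis star_ip ip_add_right star_add)

lemma ip_diff_left: "ip (x - y) z = ip x z - ip y z"
  using ip_add_left[of "x - y" y z] by (simp add: algebra_simps)

lemma ip_scaleC_left: "ip (c *\<^sub>C x) y = cnj c *\<^sub>C ip x y"
  by (metis star_ip ip_scaleC_right star_scaleC)

lemma ip_act_left: "ip (act x a) y = star a * ip x y"
  by (metis star_ip ip_act_right star_mult)

lemmas ip_simps = ip_add_right ip_diff_right ip_scaleC_right
  ip_add_left ip_diff_left ip_scaleC_left ip_act_left

lemma eq_if_ip_left_eq: "x = y" if "\<And>z. ip x z = ip y z"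
  using that[of "x - y"] ip_eq_zero_iff[of "x - y"] by (simp add: ip_diff_left)

lemma eq_if_ip_right_eq: "x = y" if "\<And>z. ip z x = ip z y"
  using that[of "x - y"] ip_eq_zero_iff[of "x - y"] by (simp add: ip_diff_right)

lemma norm_ip_self: "norm (ip x x) = (norm x)\<^sup>2"
  by (simp add: norm_ip)

lemma norm_scaleC_module: "norm (c *\<^sub>C x) = cmod c * norm (x::'x)"
proof -
  have "norm (ip (c *\<^sub>C x) (c *\<^sub>C x)) = (cmod c)\<^sup>2 * norm (ip x x)"
    by (simp add: ip_scaleC_left ip_scaleC_right norm_scaleC power2_eq_square)
  then show ?thesis
    unfolding norm_ip[of "c *\<^sub>C x"] norm_ip[of x] by (simp add: real_sqrt_mult)
qed

text \<open>Twice the symmetric part of the inner product is the difference of the inner squares of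
  \<open>x + y\<close> and \<open>x - y\<close>.\<close>

lemma norm_ip_symmetric_part_le: "norm (ip x y + ip y x) \<le> (norm x + norm y)\<^sup>2"
proof -
  have "2 *\<^sub>R (ip x y + ip y x) = ip (x + y) (x + y) - ip (x - y) (x - y)"
    by (simp add: ip_simps scaleR_2)
  then have "2 * norm (ip x y + ip y x) = norm (ip (x + y) (x + y) - ip (x - y) (x - y))"
    by (metis norm_scaleR abs_numeral)
  also have "\<dots> \<le> (norm (x + y))\<^sup>2 + (norm (x - y))\<^sup>2"
    using norm_triangle_ineq4 norm_ip_self by metis
  also have "\<dots> \<le> (norm x + norm y)\<^sup>2 + (norm x + norm y)\<^sup>2"
    by (intro add_mono power_mono norm_triangle_ineq norm_triangle_ineq4 norm_ge_zero)
  finally show ?thesis by simp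
qed

text \<open>Replacing \<open>y\<close> by \<open>i y\<close> turns the bound on the symmetric part into one on the antisymmetric
  part; rescaling both vectors to norm one turns the sum into a product.\<close>

lemma norm_ip_le: "norm (ip x y) \<le> 4 * norm x * norm y"
proof -
  have sum_bound: "norm (ip x y) \<le> (norm x + norm y)\<^sup>2" for x y
  proof -
    have "ip x (\<i> *\<^sub>C y) + ip (\<i> *\<^sub>C y) x = \<i> *\<^sub>C (ip x y - ip y x)"
      by (simp add: ip_simps scaleC_diff_right scaleC_minus_left)
    then have "norm (ip x y - ip y x) \<le> (norm x + norm y)\<^sup>2"
      using norm_ip_symmetric_part_le[of x "\<i> *\<^sub>C y"]
      by (simp add: norm_scaleC norm_scaleC_module)
    moreover have "2 *\<^sub>R ip x y = (ip x y + ip y x) + (ip x y - ip y x)"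
      by (simp add: scaleR_2)
    then have "2 * norm (ip x y) \<le> norm (ip x y + ip y x) + norm (ip x y - ip y x)"
      by (metis norm_triangle_ineq norm_scaleR abs_numeral)
    ultimately show ?thesis
      using norm_ip_symmetric_part_le[of x y] by linarith
  qed
  show ?thesis
  proof (cases "x = 0 \<or> y = 0")
    case True
    then show ?thesis
      by (metis ip_zero_right star_ip add_0 ip_add_left add_cancel_right_left norm_zero
          mult_zero_left mult_zero_right order_refl)
  next
    case False
    let ?u = "complex_of_real (1 / norm x) *\<^sub>C x" and ?v = "complex_of_real (1 / norm y) *\<^sub>C y"
    have "norm ?u = 1" "norm ?v = 1"
      using False by (simp_all add: norm_scaleC_module norm_divide)
    then have "norm (ip ?u ?v) \<le> 4"
      using sum_bound[of ?u ?v] by simp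
    moreover have "norm (ip ?u ?v) = norm (ip x y) / (norm x * norm y)"
      by (simp add: ip_simps norm_scaleC norm_divide)
    ultimately have "norm (ip x y) / (norm x * norm y) \<le> 4"
      by simp
    then show ?thesis
      using False by (simp add: pos_divide_le_eq mult.assoc)
  qed
qed

lemma bounded_linear_ip_left: "bounded_linear (\<lambda>x. ip x y)"
proof (rule bounded_linear_intro)
  show "ip (x + x') y = ip x y + ip x' y" for x x'
    by (rule ip_add_left)
  show "ip (r *\<^sub>R x) y = r *\<^sub>R ip x y" for r x
    by (simp add: scaleR_scaleC ip_scaleC_left)
  show "norm (ip x y) \<le> norm x * (4 * norm y)" for x
    using norm_ip_le[of x y] by (simp add: ac_simps)
qed

end

section \<open>Mappings between Hilbert modules\<close>

locale hilbert_module_pair =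
  X: hilbert_module actX ipX + Y: hilbert_module actY ipY
  for actX :: "'x::{complex_vector,banach} \<Rightarrow> 'a::cstar_algebra \<Rightarrow> 'x"
    and ipX :: "'x \<Rightarrow> 'x \<Rightarrow> 'a"
    and actY :: "'y::{complex_vector,banach} \<Rightarrow> 'a \<Rightarrow> 'y"
    and ipY :: "'y \<Rightarrow> 'y \<Rightarrow> 'a"
begin

lemma module_adjoint_eq:
  assumes "is_adjoint ipX ipY f g"
  shows "module_adjoint ipX ipY f = g"
  unfolding module_adjoint_def
proof (rule the_equality)
  show "g' = g" if "is_adjoint ipX ipY f g'" for g'
  proof
    show "g' y = g y" for y
      using assms that by (intro X.eq_if_ip_right_eq) (metis is_adjoint_def)
  qed
qed (rule assms)

text \<open>Both sides of each linearity law for \<open>f\<close>, paired with any \<open>y\<close>, are limits of the same sequence,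
  because \<open>x \<mapsto> \<langle>x, h n y\<rangle>\<close> obeys the conjugate law exactly for every \<open>n\<close>.\<close>

lemma module_linear_if_limit:
  assumes lim: "\<And>x y. (\<lambda>n::nat. ipX x (h n y)) \<longlonglongrightarrow> ipY (f x) y"
  shows "module_linear actX actY f"
  unfolding module_linear_def
proof (intro conjI allI; rule Y.eq_if_ip_left_eq)
  fix x x' y
  show "ipY (f (x + x')) y = ipY (f x + f x') y"
    using lim[of "x + x'" y] tendsto_add[OF lim[of x y] lim[of x' y]]
    by (simp add: X.ip_simps Y.ip_simps LIMSEQ_unique)
next
  fix c x y
  show "ipY (f (c *\<^sub>C x)) y = ipY (c *\<^sub>C f x) y"
    using lim[of "c *\<^sub>C x" y] tendsto_scaleC[OF lim[of x y], of "cnj c"]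
    by (simp add: X.ip_simps Y.ip_simps LIMSEQ_unique)
next
  fix x a y
  show "ipY (f (actX x a)) y = ipY (actY (f x) a) y"
    using lim[of "actX x a" y] tendsto_mult[OF tendsto_const lim[of x y], of "star a"]
    by (simp add: X.ip_simps Y.ip_simps LIMSEQ_unique)
qed

lemma perturbed_adjoint_limit:
  assumes "\<And>n. d n \<noteq> 0"
    and pert: "\<And>x y. norm (ipY (f x) y - ipX x (g y)) \<le> \<phi> x y"
    and lim: "\<And>x y. (\<lambda>n::nat. inverse (cmod (d n)) * \<phi> x (d n *\<^sub>C y)) \<longlonglongrightarrow> 0"
  shows "(\<lambda>n. ipX x (inverse (d n) *\<^sub>C g (d n *\<^sub>C y))) \<longlonglongrightarrow> ipY (f x) y"
proof (rule Lim_transform2[OF tendsto_const])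
  have "ipY (f x) y - ipX x (inverse (d n) *\<^sub>C g (d n *\<^sub>C y)) =
      inverse (d n) *\<^sub>C (ipY (f x) (d n *\<^sub>C y) - ipX x (g (d n *\<^sub>C y)))" for n
    using assms(1)[of n]
    by (simp add: X.ip_simps Y.ip_simps scaleC_diff_right scaleC_scaleC scaleC_one)
  then have "norm (ipY (f x) y - ipX x (inverse (d n) *\<^sub>C g (d n *\<^sub>C y))) \<le>
      inverse (cmod (d n)) * \<phi> x (d n *\<^sub>C y)" for n
    using pert by (simp add: norm_scaleC norm_inverse mult_left_mono)
  then show "(\<lambda>n. ipY (f x) y - ipX x (inverse (d n) *\<^sub>C g (d n *\<^sub>C y))) \<longlonglongrightarrow> 0"
    by (intro Lim_null_comparison[OF _ lim[of x y]]) auto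
qed

lemma perturbed_adjoint_exact:
  assumes "\<And>n. d n \<noteq> 0"
    and hom: "\<And>c x. f (c *\<^sub>C x) = c *\<^sub>C f x"
    and pert: "\<And>x y. norm (ipY (f x) y - ipX x (g y)) \<le> \<phi> x y"
    and lim: "\<And>x y. (\<lambda>n::nat. inverse (cmod (d n)) * \<phi> (d n *\<^sub>C x) y) \<longlonglongrightarrow> 0"
  shows "ipY (f x) y = ipX x (g y)"
proof -
  have "cmod (d n) * norm (ipY (f x) y - ipX x (g y)) \<le> \<phi> (d n *\<^sub>C x) y" for n
  proof -
    have "ipY (f (d n *\<^sub>C x)) y - ipX (d n *\<^sub>C x) (g y) =
        cnj (d n) *\<^sub>C (ipY (f x) y - ipX x (g y))"
      by (simp add: hom X.ip_simps Y.ip_simps scaleC_diff_right)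
    then show ?thesis
      using pert[of "d n *\<^sub>C x" y] by (simp add: norm_scaleC)
  qed
  then have "norm (ipY (f x) y - ipX x (g y)) \<le> inverse (cmod (d n)) * \<phi> (d n *\<^sub>C x) y" for n
    using assms(1)[of n] by (simp add: field_simps)
  then have "norm (ipY (f x) y - ipX x (g y)) \<le> 0"
    by (intro LIMSEQ_le_const[OF lim]) blast
  then show ?thesis by simp
qed

text \<open>The adjoint supplies the linear family \<open>x \<mapsto> \<langle>x, g y\<rangle>\<close>, the mapping its pointwise bound; pairing
  \<open>f x\<close> with its own normalization recovers the norm of \<open>f x\<close>.\<close>

lemma adjointable_bounded:
  assumes adj: "\<And>x y. ipY (f x) y = ipX x (g y)"
  shows "\<exists>K. \<forall>x. norm (f x) \<le> K * norm x"
proof -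
  have "\<exists>K. \<forall>y\<in>cball 0 1. \<forall>x. norm (ipX x (g y)) \<le> K * norm x"
  proof (rule uniform_boundedness)
    show "\<exists>M. \<forall>y\<in>cball 0 1. norm (ipX x (g y)) \<le> M" for x
    proof (intro exI ballI)
      fix y :: 'y assume "y \<in> cball 0 1"
      then have "4 * norm (f x) * norm y \<le> 4 * norm (f x)"
        by (simp add: mult_left_le)
      then show "norm (ipX x (g y)) \<le> 4 * norm (f x)"
        using Y.norm_ip_le[of "f x" y] by (simp add: adj)
    qed
  qed (rule X.bounded_linear_ip_left)
  then obtain K where K: "\<And>x y. norm y \<le> 1 \<Longrightarrow> norm (ipY (f x) y) \<le> K * norm x"
    unfolding adj by (metis mem_cball_0)
  have "norm (f x) \<le> K * norm x" for x
  proof -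
    \<comment> \<open>If \<open>f x = 0\<close>, division by zero makes this \<open>0\<close>, and the computation below still holds.\<close>
    let ?y = "complex_of_real (1 / norm (f x)) *\<^sub>C f x"
    have "norm (ipY (f x) ?y) = norm (f x)"
      by (simp add: Y.ip_scaleC_right norm_scaleC norm_divide Y.norm_ip_self power2_eq_square)
    moreover have "norm ?y \<le> 1"
      by (simp add: Y.norm_scaleC_module norm_divide)
    ultimately show ?thesis
      using K[of ?y x] by simp
  qed
  then show ?thesis by blast
qed

lemma bounded_module_linear_continuous:
  assumes "module_linear actX actY f" and "\<And>x. norm (f x) \<le> K * norm x"
  shows "continuous_on UNIV f"
proof (rule linear_continuous_on, rule bounded_linear_intro)
  show "f (x + x') = f x + f x'" for x x'
    using assms(1) by (simp add: module_linear_def)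
  show "f (r *\<^sub>R x) = r *\<^sub>R f x" for r x
    using assms(1) by (simp add: module_linear_def scaleR_scaleC)
  show "norm (f x) \<le> norm x * K" for x
    using assms(2) by (simp add: mult.commute)
qed

end

section \<open>Perturbations of adjointable mappings\<close>

theorem theorem2p3:
  fixes actX :: "'x::{complex_vector,banach} \<Rightarrow> 'a::cstar_algebra \<Rightarrow> 'x"
    and ipX :: "'x \<Rightarrow> 'x \<Rightarrow> 'a"
    and actY :: "'y::{complex_vector,banach} \<Rightarrow> 'a \<Rightarrow> 'y"
    and ipY :: "'y \<Rightarrow> 'y \<Rightarrow> 'a"
    and \<phi> :: "'x \<Rightarrow> 'y \<Rightarrow> real"
    and f :: "'x \<Rightarrow> 'y"
    and g :: "'y \<Rightarrow> 'x"
    and c :: "nat \<Rightarrow> complex"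
  assumes X: "hilbert_module actX ipX"
    and Y: "hilbert_module actY ipY"
    and phi_nonneg: "\<And>x y. 0 \<le> \<phi> x y"
    and perturbation: "\<And>x y. norm (ipY (f x) y - ipX x (g y)) \<le> \<phi> x y"
    and c_nonzero: "\<And>n. c n \<noteq> 0"
    and limits:
      "((\<forall>x y. (\<lambda>n. inverse (cmod (c n)) * \<phi> (c n *\<^sub>C x) y) \<longlonglongrightarrow> 0) \<and>
        (\<forall>x y. (\<lambda>n. inverse (cmod (c n)) * \<phi> x (c n *\<^sub>C y)) \<longlonglongrightarrow> 0)) \<or>
       ((\<forall>x y. (\<lambda>n. cmod (c n) * \<phi> (inverse (c n) *\<^sub>C x) y) \<longlonglongrightarrow> 0) \<and>
        (\<forall>x y. (\<lambda>n. cmod (c n) * \<phi> x (inverse (c n) *\<^sub>C y)) \<longlonglongrightarrow> 0))"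
  shows "adjointable ipX ipY f \<and>
    (\<exists>K. \<forall>x. norm (f x) \<le> K * norm x) \<and>
    continuous_on UNIV f \<and>
    module_linear actX actY f \<and>
    module_adjoint ipX ipY f = g \<and>
    (\<forall>x y. ipY (f x) y = ipX x (g y))"
proof -
  interpret hilbert_module_pair actX ipX actY ipY
    using X Y by (rule hilbert_module_pair.intro)
  obtain d :: "nat \<Rightarrow> complex" where d: "\<And>n. d n \<noteq> 0"
    and limX: "\<And>x y. (\<lambda>n. inverse (cmod (d n)) * \<phi> (d n *\<^sub>C x) y) \<longlonglongrightarrow> 0"
    and limY: "\<And>x y. (\<lambda>n. inverse (cmod (d n)) * \<phi> x (d n *\<^sub>C y)) \<longlonglongrightarrow> 0"
    using limits
  proof
    assume *: "(\<forall>x y. (\<lambda>n. cmod (c n) * \<phi> (inverse (c n) *\<^sub>C x) y) \<longlonglongrightarrow> 0) \<and>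
        (\<forall>x y. (\<lambda>n. cmod (c n) * \<phi> x (inverse (c n) *\<^sub>C y)) \<longlonglongrightarrow> 0)"
    show thesis
      by (rule that[of "\<lambda>n. inverse (c n)"]) (use * c_nonzero in \<open>simp_all add: norm_inverse\<close>)
  qed (use that[of c] c_nonzero in blast)
  have lin: "module_linear actX actY f"
    using perturbed_adjoint_limit[OF d perturbation limY] by (rule module_linear_if_limit)
  then have "f (k *\<^sub>C x) = k *\<^sub>C f x" for k x
    by (simp add: module_linear_def)
  then have adj: "ipY (f x) y = ipX x (g y)" for x y
    using perturbed_adjoint_exact[OF d _ perturbation limX] by blast
  then have "is_adjoint ipX ipY f g"
    by (simp add: is_adjoint_def)
  moreover obtain K where "\<And>x. norm (f x) \<le> K * norm x"
    using adjointable_bounded[OF adj] by blast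
  ultimately show ?thesis
    using lin adj bounded_module_linear_continuous[OF lin] module_adjoint_eq
    unfolding adjointable_def by blast
qed

end
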